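(* Let $N^h\ge 2$ be an integer and $h=1/N^h$. Let $\lambda_j=j^2\pi^2$ be the $j$-th exact eigenvalue of $-u''=\lambda u$ on $(0,1)$ with $u(0)=u(1)=0$, and let $\lambda^h_{gsq,j}$ be the $j$-th approximate eigenvalue (eigenvalues sorted in nondecreasing order, counting multiplicity) of the linear GSFEMBQ generalized matrix eigenvalue problem $(\mathbf{K}-\eta_K\mathbf{S})\mathbf{U}=\lambda^h(\alpha\mathbf{M}_G+(1-\alpha)\mathbf{M}_L+\eta_M\mathbf{S}_g)\mathbf{U}$ described in the context, with $\eta_K=\frac{31}{252}$, $\eta_M=\frac{23}{3780}$ and $\alpha=\frac{26}{21}$. Then \[ \frac{|\lambda^h_{gsq,j}-\lambda_j|}{\lambda_j}<\frac{1}{30240}(j\pi h)^8\qquad\text{for all } j\in\{1,\dots,N^h-1\}. \]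
   Context: Setting (linear finite elements, generalized SoftFEM with blended quadrature, in 1D): Let $x_k=kh$, $k=0,\dots,N^h$, be a uniform mesh of $[0,1]$. Let $V^h$ be the space of continuous functions on $[0,1]$ that are affine on each $[x_{k-1},x_k]$ and vanish at $0$ and $1$, with hat basis $\phi_k$, $k=1,\dots,N^h-1$, $\phi_k(x_l)=\delta_{kl}$. For $v\in V^h$ and an interior node $x_k$ let $[\![v']\!](x_k)=v'(x_k^-)-v'(x_k^+)$. Define $a(v,w)=\int_0^1 v'w'\,dx$, $s(v,w)=\sum_{k=1}^{N^h-1} h\,[\![v']\!](x_k)[\![w']\!](x_k)$, $s_g(v,w)=\sum_{k=1}^{N^h-1} h^3\,[\![v']\!](x_k)[\![w']\!](x_k)$, $\mathbf{K}_{kl}=a(\phi_l,\phi_k)$, $\mathbf{S}_{kl}=s(\phi_l,\phi_k)$, $(\mathbf{S}_g)_{kl}=s_g(\phi_l,\phi_k)$. $\mathbf{M}_G$ is the mass matrix $\int_0^1\phi_l\phi_k\,dx$ computed elementwise by the 2-point Gauss–Legendre rule, and $\mathbf{M}_L$ the one computed by the 2-point Gauss–Lobatto (trapezoidal) rule. Explicitly, $\mathbf{K}=\frac1h\,\mathrm{tridiag}(-1,2,-1)$, $\mathbf{M}_G=h\,\mathrm{tridiag}(\tfrac16,\tfrac23,\tfrac16)$, $\mathbf{M}_L=h\,\mathbf{I}$, $\mathbf{S}=\frac1h$ times the symmetric pentadiagonal matrix with rows $(1,-4,6,-4,1)$ except that the first and last diagonal entries are $5$, and $\mathbf{S}_g=h^2\mathbf{S}$;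 all are $(N^h-1)\times(N^h-1)$. *)

theory Defs
  imports "Jordan_Normal_Form.Determinant" "HOL-Library.Multiset"
begin

(* Uniform mesh x_k = k h of [0,1], h = 1/N. Interior nodes x_1..x_{N-1}.
   Matrix indices i = 0..N-2 correspond to hat functions / nodes i+1. *)

definition mesh_h :: "nat \<Rightarrow> real" where
  "mesh_h N = 1 / real N"

(* jump [[phi_k']](x_m) = phi_k'(x_m^-) - phi_k'(x_m^+) of the hat function phi_k
   at node x_m (1-based node indices) *)
definition hat_jump :: "nat \<Rightarrow> nat \<Rightarrow> nat \<Rightarrow> real" where
  "hat_jump N k m =
     (if m = k then 2 / mesh_h N
      else if m + 1 = k \<or> m = k + 1 then - 1 / mesh_h N
      else 0)"

definition stiff_K :: "nat \<Rightarrow> real mat" where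
  "stiff_K N = mat (N - 1) (N - 1) (\<lambda>(i, j).
      (if i = j then 2 else if i + 1 = j \<or> j + 1 = i then - 1 else 0) / mesh_h N)"

(* Gauss-Legendre (consistent) mass matrix M_G = h tridiag(1/6,2/3,1/6) *)
definition mass_G :: "nat \<Rightarrow> real mat" where
  "mass_G N = mat (N - 1) (N - 1) (\<lambda>(i, j).
      mesh_h N * (if i = j then 2/3 else if i + 1 = j \<or> j + 1 = i then 1/6 else 0))"

(* Gauss-Lobatto (lumped) mass matrix M_L = h I *)
definition mass_L :: "nat \<Rightarrow> real mat" where
  "mass_L N = mat (N - 1) (N - 1) (\<lambda>(i, j). if i = j then mesh_h N else 0)"

definition soft_S :: "nat \<Rightarrow> real mat" where
  "soft_S N = mat (N - 1) (N - 1) (\<lambda>(i, j).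
      (\<Sum>m = 1..N - 1. mesh_h N * hat_jump N (j + 1) m * hat_jump N (i + 1) m))"

definition soft_Sg :: "nat \<Rightarrow> real mat" where
  "soft_Sg N = mat (N - 1) (N - 1) (\<lambda>(i, j).
      (\<Sum>m = 1..N - 1. mesh_h N ^ 3 * hat_jump N (j + 1) m * hat_jump N (i + 1) m))"

definition gen_char_poly :: "real mat \<Rightarrow> real mat \<Rightarrow> real poly" where
  "gen_char_poly A B =
     det (map_mat (\<lambda>a. [:a:]) A - [:0, 1:] \<cdot>\<^sub>m map_mat (\<lambda>b. [:b:]) B)"

definition gen_eigenvalues :: "real mat \<Rightarrow> real mat \<Rightarrow> real list" where
  "gen_eigenvalues A B = sorted_list_of_multiset (proots (gen_char_poly A B))"

definition gsq_eigenvalues :: "nat \<Rightarrow> real \<Rightarrow> real \<Rightarrow> real \<Rightarrow> real list" where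
  "gsq_eigenvalues N etaK etaM alpha =
     gen_eigenvalues (stiff_K N - etaK \<cdot>\<^sub>m soft_S N)
       (alpha \<cdot>\<^sub>m mass_G N + (1 - alpha) \<cdot>\<^sub>m mass_L N + etaM \<cdot>\<^sub>m soft_Sg N)"

end

theory Submission
  imports Defs "Jordan_Normal_Form.Char_Poly"
begin

text \<open>
  Both sides of the matrix problem are quadratic polynomials in the second difference matrix
  \<open>T = tridiag(-1, 2, -1)\<close>, so the sine vectors diagonalise it and the eigenvalues are
  \<open>f (2 - 2 cos x) / h\<^sup>2\<close> at \<open>x = j \<pi> h\<close> with a rational function \<open>f\<close> that is increasing on
  \<open>[0, 4]\<close>. The claim becomes \<open>\<bar>f (2 - 2 cos x) - x\<^sup>2\<bar> < x\<^sup>1\<^sup>0 / 30240\<close> on \<open>(0, \<pi>)\<close>. By monotonicity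
  \<open>2 - 2 cos x\<close> may be replaced by its Taylor bounds, which leaves two polynomial inequalities in
  \<open>y = x\<^sup>2\<close> on \<open>(0, 10)\<close>; after division by \<open>y\<^sup>5\<close> all Bernstein coefficients on this interval are
  positive.
\<close>

section \<open>The eigenvalue function and Taylor bounds for the cosine\<close>

text \<open>The symbol of the pencil: if \<open>t\<close> is an eigenvalue of
  \<open>T = tridiag(-1, 2, -1)\<close>, the generalized eigenvalue is this value divided by the
  square of the mesh size. The term \<open>alpha / 6 * t\<close> is what remains of the blended mass
  matrices, since \<open>M_G = h (I - T/6)\<close> and \<open>M_L = h I\<close>.\<close>

definition gsq_ratio :: "real \<Rightarrow> real \<Rightarrow> real \<Rightarrow> real \<Rightarrow> real" where
  "gsq_ratio etaK etaM alpha t = (t - etaK * t^2) / (1 - alpha / 6 * t + etaM * t^2)"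

text \<open>The Lagrange remainder is a cosine value times \<open>x^8 / 8!\<close>; the power is
  even, so bounding that cosine by 1 suffices.\<close>

lemma cos_taylor_upper:
  fixes x :: real
  shows "cos x \<le> 1 - x^2/2 + x^4/24 - x^6/720 + x^8/40320"
proof -
  obtain t where "cos x = (\<Sum>m<8. cos_coeff m * x ^ m) + (cos (t + 1/2 * real 8 * pi) / fact 8) * x ^ 8"
    using Maclaurin_cos_expansion[of x 8] by auto
  moreover have "cos (t + 1/2 * real 8 * pi) / fact 8 * x ^ 8 \<le> 1 / fact 8 * x ^ 8"
    by (intro mult_right_mono divide_right_mono) auto
  moreover have "(\<Sum>m<8. cos_coeff m * x ^ m) = 1 - x^2/2 + x^4/24 - x^6/720"
    by (simp add: cos_coeff_def lessThan_nat_numeral lessThan_Suc fact_numeral)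
  ultimately show ?thesis by (simp add: fact_numeral)
qed

lemma cos_taylor_lower:
  fixes x :: real
  shows "1 - x^2/2 + x^4/24 - x^6/720 + x^8/40320 - x^10/3628800 \<le> cos x"
proof -
  obtain t where "cos x = (\<Sum>m<10. cos_coeff m * x ^ m) + (cos (t + 1/2 * real 10 * pi) / fact 10) * x ^ 10"
    using Maclaurin_cos_expansion[of x 10] by auto
  moreover have "(- 1) / fact 10 * x ^ 10 \<le> cos (t + 1/2 * real 10 * pi) / fact 10 * x ^ 10"
    by (intro mult_right_mono divide_right_mono) auto
  moreover have "(\<Sum>m<10. cos_coeff m * x ^ m) = 1 - x^2/2 + x^4/24 - x^6/720 + x^8/40320"
    by (simp add: cos_coeff_def lessThan_nat_numeral lessThan_Suc fact_numeral)
  ultimately show ?thesis by (simp add: fact_numeral)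
qed

text \<open>Makes 10 a rational right endpoint for the range of \<open>y = x^2\<close>.\<close>

lemma pi_squared_less_10: "pi^2 < 10"
proof -
  \<comment> \<open>The square of \<open>79/25\<close> is just below 10, while its half
    \<open>79/50\<close> already lies beyond the first zero of the cosine, as the Taylor bound
    detects.\<close>
  have "pi < 79/25"
  proof (rule ccontr)
    assume "\<not> pi < 79/25"
    then have "0 \<le> cos (79/50 :: real)" using pi_gt_zero by (intro cos_ge_zero) auto
    moreover have "cos (79/50 :: real) < 0"
      using cos_taylor_upper[of "79/50 :: real"] by (simp add: field_simps)
    ultimately show False by simp
  qed
  then have "pi^2 < (79/25)^2" by (intro power_strict_mono) auto
  then show ?thesis by (simp add: power2_eq_square)
qed


lemma two_minus_two_cos_bounds:
  fixes x :: real
  defines "y \<equiv> x^2"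
  shows "y - y^2/12 + y^3/360 - y^4/20160 \<le> 2 - 2 * cos x"
    and "2 - 2 * cos x \<le> y - y^2/12 + y^3/360 - y^4/20160 + y^5/1814400"
  using cos_taylor_upper[of x] cos_taylor_lower[of x]
  by (simp_all add: y_def flip: power_mult)

section \<open>Positivity of the denominator and monotonicity of the symbol\<close>

text \<open>The bound 5 rather than 4 leaves room for the Taylor upper bound of
  \<open>2 - 2 * cos x\<close>, which exceeds 4 near \<open>x = pi\<close>.\<close>

lemma gsq_ratio_denominator_pos:
  fixes t :: real
  assumes "t \<le> 5"
  shows "0 < 1 - (26/21) / 6 * t + 23/3780 * t^2"
proof -
  \<comment> \<open>Expansion about 5 in powers of \<open>5 - t\<close>, with positive coefficients
    only.\<close>
  have "1 - (26/21) / 6 * t + 23/3780 * t^2 = 455/3780 + (5 - t) * (550/3780 + 23/3780 * (5 - t))"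
    by (simp add: field_simps power2_eq_square)
  moreover have "0 \<le> (5 - t) * (550/3780 + 23/3780 * (5 - t))"
    using assms by simp
  ultimately show ?thesis by simp
qed

text \<open>After cross-multiplication by the positive denominators, the difference of the two sides
  factors as \<open>(t - s) * D\<close>, so only the sign of \<open>D\<close> matters.\<close>

lemma gsq_ratio_strict_mono:
  assumes "0 \<le> s" "s < t" "t \<le> 5" "s \<le> 4"
  shows "gsq_ratio (31/252) (23/3780) (26/21) s < gsq_ratio (31/252) (23/3780) (26/21) t"
proof -
  define D where "D = 1 - 31/252 * (t + s) + 383/19845 * (t * s)"
  have "(t - 31/252 * t^2) * (1 - (26/21) / 6 * s + 23/3780 * s^2)
      - (s - 31/252 * s^2) * (1 - (26/21) / 6 * t + 23/3780 * t^2) = (t - s) * D"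
    by (simp add: D_def field_simps power2_eq_square)
  moreover have "0 < (t - s) * D"
  proof -
    \<comment> \<open>\<open>D\<close> is bilinear in \<open>s\<close> and \<open>t\<close>, hence an average of its (positive) values at the corners of \<open>[0,5] \<times> [0,4]\<close>.\<close>
    have "20 * D = (5 - t) * (4 - s) + 97/252 * (t * (4 - s)) + 32/63 * ((5 - t) * s)
        + 4427/15876 * (t * s)"
      by (simp add: D_def field_simps)
    moreover have "0 < t * (4 - s) \<or> 0 < t * s"
      using assms by (cases "s = 0") auto
    moreover have "0 \<le> (5 - t) * (4 - s)" "0 \<le> t * (4 - s)" "0 \<le> (5 - t) * s" "0 \<le> t * s"
      using assms by auto
    ultimately have "0 < D" by linarith
    then show ?thesis using assms by simp
  qed
  ultimately have "(s - 31/252 * s^2) * (1 - (26/21) / 6 * t + 23/3780 * t^2)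
      < (t - 31/252 * t^2) * (1 - (26/21) / 6 * s + 23/3780 * s^2)"
    by linarith
  then show ?thesis
    unfolding gsq_ratio_def
    using gsq_ratio_denominator_pos[of s] gsq_ratio_denominator_pos[of t] assms
    by (simp add: frac_less_eq divide_less_0_iff)
qed


section \<open>Error of the symbol on the interval from 0 to pi\<close>

text \<open>For these three parameters the ratio at \<open>l\<close> agrees with \<open>y\<close>
  through the power \<open>y^4\<close>. Hence the cleared difference is divisible by
  \<open>y^5\<close>, and only the sign of the quotient has to be checked.\<close>

lemma gsq_ratio_taylor_lower:
  fixes y :: real
  assumes "0 < y" "y \<le> 10"
  defines "l \<equiv> y - y^2/12 + y^3/360 - y^4/20160"
  assumes "l \<le> 5"
  shows "y - y^5/30240 < gsq_ratio (31/252) (23/3780) (26/21) l"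
proof -
  define a where "a = 20160 * y - 1680 * y^2 + 56 * y^3 - y^4"
  define b where "b = 10 - y"
  define q where "q = 115640784 * b ^ 8 + 535370472 * (y * b ^ 7) + 1022499072 * (y ^ 2 * b ^ 6)
    + 997048899 * (y ^ 3 * b ^ 5) + 496927305 * (y ^ 4 * b ^ 4) + 123009054 * (y ^ 5 * b ^ 3)
    + 48649202 * (y ^ 6 * b ^ 2) + 39238367 * (y ^ 7 * b) + 11309804 * y ^ 8"
  \<comment> \<open>\<open>q\<close> is the Bernstein form on \<open>[0, 10]\<close> of the quotient of the cleared inequality by \<open>y\<^sup>5\<close>.\<close>
  have l: "l = a / 20160" by (simp add: l_def a_def)
  have "0 \<le> b" using assms by (simp add: b_def)
  then have "0 < q" using assms(1) unfolding q_def
    by (intro add_nonneg_pos add_nonneg_nonneg) auto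
  \<comment> \<open>The numbers 465, 780 and 23 are the numerators of the coefficients over the
    common denominator 3780. The factor 15625 clears the powers of 1/10 that arise from homogenizing
    with \<open>y + b = 10\<close>.\<close>
  moreover have "15625 * (30240 * (3780 * 20160 * a - 465 * a^2)
      - (30240 * y - y^5) * (3780 * 20160^2 - 780 * 20160 * a + 23 * a^2)) = y^5 * q"
    unfolding a_def q_def b_def by (simp add: algebra_simps eval_nat_numeral)
  ultimately have "0 < 30240 * (3780 * 20160 * a - 465 * a^2)
      - (30240 * y - y^5) * (3780 * 20160^2 - 780 * 20160 * a + 23 * a^2)"
    using assms(1) by (metis mult_pos_pos zero_less_mult_pos zero_less_numeral zero_less_power)
  then have "(y - y^5/30240) * (1 - (26/21) / 6 * l + 23/3780 * l^2) < l - 31/252 * l^2"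
    by (simp add: l field_simps power2_eq_square)
  then show ?thesis
    using gsq_ratio_denominator_pos[OF \<open>l \<le> 5\<close>] by (simp add: gsq_ratio_def pos_less_divide_eq)
qed

lemma gsq_ratio_taylor_upper:
  fixes y :: real
  assumes "0 < y" "y \<le> 10"
  defines "u \<equiv> y - y^2/12 + y^3/360 - y^4/20160 + y^5/1814400"
  assumes "u \<le> 5"
  shows "gsq_ratio (31/252) (23/3780) (26/21) u < y + y^5/30240"
proof -
  define a where "a = 1814400 * y - 151200 * y^2 + 5040 * y^3 - 90 * y^4 + y^5"
  define b where "b = 10 - y"
  define q where "q = 29196345024 * b ^ 10 + 243418611240 * (y * b ^ 9) + 925652561400 * (y ^ 2 * b ^ 8)
    + 2113933849965 * (y ^ 3 * b ^ 7) + 3212132806575 * (y ^ 4 * b ^ 6)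
    + 3396573954018 * (y ^ 5 * b ^ 5) + 2534418125190 * (y ^ 6 * b ^ 4)
    + 1319411140425 * (y ^ 7 * b ^ 3) + 459111054690 * (y ^ 8 * b ^ 2)
    + 96461280000 * (y ^ 9 * b) + 9288302144 * y ^ 10"
  have u: "u = a / 1814400" by (simp add: u_def a_def)
  have "0 \<le> b" using assms by (simp add: b_def)
  then have "0 < q" using assms(1) unfolding q_def
    by (intro add_nonneg_pos add_nonneg_nonneg) auto
  moreover have "15625 * ((30240 * y + y^5) * (3780 * 1814400^2 - 780 * 1814400 * a + 23 * a^2)
      - 30240 * (3780 * 1814400 * a - 465 * a^2)) = y^5 * q"
    unfolding a_def q_def b_def by (simp add: algebra_simps eval_nat_numeral)
  ultimately have "0 < (30240 * y + y^5) * (3780 * 1814400^2 - 780 * 1814400 * a + 23 * a^2)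
      - 30240 * (3780 * 1814400 * a - 465 * a^2)"
    using assms(1) by (metis mult_pos_pos zero_less_mult_pos zero_less_numeral zero_less_power)
  then have "u - 31/252 * u^2 < (y + y^5/30240) * (1 - (26/21) / 6 * u + 23/3780 * u^2)"
    by (simp add: u field_simps power2_eq_square)
  then show ?thesis
    using gsq_ratio_denominator_pos[OF \<open>u \<le> 5\<close>] by (simp add: gsq_ratio_def pos_divide_less_eq)
qed

lemma gsq_ratio_symbol_error:
  fixes x :: real
  assumes "0 < x" "x < pi"
  shows "\<bar>gsq_ratio (31/252) (23/3780) (26/21) (2 - 2 * cos x) - x^2\<bar> < (x^2)^5 / 30240"
proof -
  define y where "y = x^2"
  define b where "b = 10 - y"
  define l where "l = y - y^2/12 + y^3/360 - y^4/20160"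
  define u where "u = y - y^2/12 + y^3/360 - y^4/20160 + y^5/1814400"
  define t where "t = 2 - 2 * cos x"
  have "y < pi^2" using assms unfolding y_def by (intro power_strict_mono) auto
  then have y: "0 < y" "y \<le> 10" using assms pi_squared_less_10 by (auto simp: y_def)
  then have b: "0 \<le> b" by (simp add: b_def)
  have lu: "l \<le> t" "t \<le> u"
    using two_minus_two_cos_bounds[of x] by (simp_all add: l_def u_def t_def y_def)
  have t: "0 \<le> t" "t \<le> 4" using cos_ge_minus_one[of x] cos_le_one[of x] unfolding t_def by linarith+
  \<comment> \<open>Bernstein forms on \<open>[0, 10]\<close> again, now for \<open>l / y\<close>
    and \<open>5 - u\<close>: monotonicity of the symbol requires \<open>0 \<le> l\<close> and
    \<open>u \<le> 5\<close>.\<close>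
  have "504000 * l = y * (504 * b ^ 3 + 1092 * (y * b ^ 2) + 812 * (y ^ 2 * b) + 199 * y ^ 3)"
    unfolding l_def b_def by (simp add: field_simps eval_nat_numeral)
  moreover have "0 \<le> y * (504 * b ^ 3 + 1092 * (y * b ^ 2) + 812 * (y ^ 2 * b) + 199 * y ^ 3)"
    using y b by auto
  ultimately have "0 \<le> l" by linarith
  have "45360000 * (5 - u) = 2268 * b ^ 5 + 6804 * (y * b ^ 4) + 8316 * (y ^ 2 * b ^ 3)
      + 5544 * (y ^ 3 * b ^ 2) + 2241 * (y ^ 4 * b) + 452 * y ^ 5"
    unfolding u_def b_def by (simp add: field_simps eval_nat_numeral)
  moreover have "0 \<le> 2268 * b ^ 5 + 6804 * (y * b ^ 4) + 8316 * (y ^ 2 * b ^ 3)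
      + 5544 * (y ^ 3 * b ^ 2) + 2241 * (y ^ 4 * b) + 452 * y ^ 5"
    using y b by (intro add_nonneg_nonneg) auto
  ultimately have "0 \<le> 45360000 * (5 - u)" by simp
  then have "u \<le> 5" by simp
  let ?f = "gsq_ratio (31/252) (23/3780) (26/21)"
  have "y - y^5/30240 < ?f l"
    using gsq_ratio_taylor_lower[OF y] lu t by (simp add: l_def)
  also have "?f l \<le> ?f t"
    using gsq_ratio_strict_mono[of l t] \<open>0 \<le> l\<close> lu t by (cases "l = t") auto
  finally have lower: "y - y^5/30240 < ?f t" .
  have "?f t \<le> ?f u"
    using gsq_ratio_strict_mono[of t u] \<open>u \<le> 5\<close> lu t by (cases "t = u") auto
  also have "?f u < y + y^5/30240"
    using gsq_ratio_taylor_upper[OF y] \<open>u \<le> 5\<close> by (simp add: u_def)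
  finally show ?thesis using lower unfolding abs_less_iff t_def y_def by linarith
qed

section \<open>Spectrum of the second difference matrix\<close>

declare One_nat_def [simp del]

definition second_diff :: "nat \<Rightarrow> real mat" where
  "second_diff N = mat (N - 1) (N - 1) (\<lambda>(i, j).
      if i = j then 2 else if i + 1 = j \<or> j + 1 = i then - 1 else 0)"

text \<open>Samples of the exact eigenfunction \<open>sin (j * pi * x)\<close> at the interior
  nodes; entry \<open>i\<close> belongs to node \<open>i + 1\<close>.\<close>

definition sine_vec :: "nat \<Rightarrow> nat \<Rightarrow> real vec" where
  "sine_vec N j = vec (N - 1) (\<lambda>i. sin (real (i + 1) * (real j * pi / real N)))"

definition diff_eig :: "nat \<Rightarrow> nat \<Rightarrow> real" where
  "diff_eig N j = 2 - 2 * cos (real j * pi / real N)"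

lemma second_diff_carrier [simp]: "second_diff N \<in> carrier_mat (N - 1) (N - 1)"
  by (simp add: second_diff_def)

lemma second_diff_dim [simp]:
  "dim_row (second_diff N) = N - 1" "dim_col (second_diff N) = N - 1"
  by (simp_all add: second_diff_def)

lemma sine_vec_carrier [simp]: "sine_vec N j \<in> carrier_vec (N - 1)"
  by (simp add: sine_vec_def)

lemma diff_eig_range:
  assumes "j \<in> {1..<N}"
  shows "0 < diff_eig N j" "diff_eig N j < 4"
proof -
  have x: "0 < real j * pi / real N" "real j * pi / real N < pi"
    using assms by (auto simp: field_simps)
  then show "0 < diff_eig N j"
    using cos_monotone_0_pi[of 0 "real j * pi / real N"] by (simp add: diff_eig_def)
  show "diff_eig N j < 4"
    using x cos_monotone_0_pi[of "real j * pi / real N" pi] by (simp add: diff_eig_def)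
qed

lemma diff_eig_less:
  assumes "i < j" "j < N"
  shows "diff_eig N i < diff_eig N j"
  using assms cos_monotone_0_pi[of "real i * pi / real N" "real j * pi / real N"]
  by (simp add: diff_eig_def field_simps)

lemma sine_vec_nonzero:
  assumes "j \<in> {1..<N}"
  shows "sine_vec N j \<noteq> 0\<^sub>v (N - 1)"
proof
  assume "sine_vec N j = 0\<^sub>v (N - 1)"
  then have "sine_vec N j $ 0 = 0\<^sub>v (N - 1) $ 0" by simp
  then have "sin (real j * pi / real N) = 0" using assms by (simp add: sine_vec_def)
  moreover have "sin (real j * pi / real N) > 0"
    using assms by (intro sin_gt_zero) (auto simp: field_simps)
  ultimately show False by simp
qed

text \<open>The addition theorem gives \<open>sin (p + q) + sin (p - q) = 2 * sin p * cos q\<close>.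
  The first and last rows fit the same three-term formula because the sine vanishes at both boundary
  nodes.\<close>

lemma second_diff_sine_vec:
  assumes j: "j \<in> {1..<N}"
  shows "second_diff N *\<^sub>v sine_vec N j = diff_eig N j \<cdot>\<^sub>v sine_vec N j"
proof (rule eq_vecI)
  fix i assume "i < dim_vec (diff_eig N j \<cdot>\<^sub>v sine_vec N j)"
  then have i: "i < N - 1" by (simp add: sine_vec_def)
  define \<theta> where "\<theta> = real j * pi / real N"
  define s where "s k = sin (real k * \<theta>)" for k
  have sN: "s N = 0" using j by (simp add: s_def \<theta>_def)
  \<comment> \<open>Truncated subtraction gives \<open>i = i - 1\<close> only for
    \<open>i = 0\<close>. The lower-neighbour term \<open>k = i - 1\<close> then falls on the
    diagonal and contributes \<open>s 0 = 0\<close>.\<close>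
  have edge: "s i = 0" if "i = i - 1" using that by (cases i) (auto simp: s_def)
  have "(second_diff N *\<^sub>v sine_vec N j) $ i =
      (\<Sum>k = 0..<N - 1. (if i = k then 2 else if i + 1 = k \<or> k + 1 = i then - 1 else 0) * s (k + 1))"
    using i by (simp add: second_diff_def sine_vec_def scalar_prod_def s_def \<theta>_def)
  also have "\<dots> = (\<Sum>k = 0..<N - 1. (if i = k then 2 * s (i + 1) else 0)
      - (if i + 1 = k then s (i + 1 + 1) else 0) - (if k = i - 1 then s i else 0))"
    using edge by (intro sum.cong) (auto split: if_splits)
  also have "\<dots> = 2 * s (i + 1) - s (i + 1 + 1) - s i"
  proof -
    have "(if i + 1 < N - 1 then s (i + 1 + 1) else 0) = s (i + 1 + 1)"
    proof (cases "i + 1 < N - 1")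
      case False
      then have "i + 1 + 1 = N" using i by simp
      then show ?thesis using sN by (simp only: if_False False)
    qed simp
    moreover have "i - 1 < N - 1" using i by simp
    ultimately show ?thesis
      using i by (simp add: sum_subtractf sum.delta sum.delta')
  qed
  also have "\<dots> = (2 - 2 * cos \<theta>) * s (i + 1)"
  proof -
    define \<phi> where "\<phi> = real (i + 1) * \<theta>"
    have "s (i + 1 + 1) = sin (\<phi> + \<theta>)" "s i = sin (\<phi> - \<theta>)" "s (i + 1) = sin \<phi>"
      by (simp_all add: s_def \<phi>_def algebra_simps)
    then show ?thesis by (simp add: sin_add sin_diff algebra_simps)
  qed
  also have "\<dots> = (diff_eig N j \<cdot>\<^sub>v sine_vec N j) $ i"
    using i by (simp add: sine_vec_def diff_eig_def s_def \<theta>_def)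
  finally show "(second_diff N *\<^sub>v sine_vec N j) $ i = (diff_eig N j \<cdot>\<^sub>v sine_vec N j) $ i" .
qed (simp add: second_diff_def sine_vec_def)

text \<open>The sine vectors supply \<open>N - 1\<close> distinct roots of a characteristic
  polynomial of degree \<open>N - 1\<close>, which leaves no room for others.\<close>

lemma eigenvalue_second_diff:
  assumes "eigenvalue (second_diff N) c"
  shows "c \<in> diff_eig N ` {1..<N}"
proof -
  let ?p = "char_poly (second_diff N)"
  note root = eigenvalue_root_char_poly[OF second_diff_carrier, of N]
  have deg: "degree ?p = N - 1" "?p \<noteq> 0"
    using degree_monic_char_poly[OF second_diff_carrier, of N] by auto
  have "inj_on (diff_eig N) {1..<N}"
    by (rule linorder_inj_onI) (auto dest: diff_eig_less)
  then have "card (diff_eig N ` {1..<N}) = N - 1"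
    by (simp add: card_image)
  moreover have "diff_eig N ` {1..<N} \<subseteq> {x. poly ?p x = 0}"
  proof
    fix c assume "c \<in> diff_eig N ` {1..<N}"
    then obtain j where j: "j \<in> {1..<N}" and c: "c = diff_eig N j" by blast
    have "eigenvector (second_diff N) (sine_vec N j) c"
      using second_diff_sine_vec[OF j] sine_vec_nonzero[OF j] by (simp add: eigenvector_def c)
    then show "c \<in> {x. poly ?p x = 0}"
      using root eigenvalue_def by blast
  qed
  moreover have "card {x. poly ?p x = 0} \<le> N - 1"
    using card_poly_roots_bound[OF deg(2)] deg(1) by simp
  ultimately have "diff_eig N ` {1..<N} = {x. poly ?p x = 0}"
    using poly_roots_finite[OF deg(2)] by (intro card_seteq) auto
  then show ?thesis using assms by (simp add: root)
qed

section \<open>The system matrices as polynomials in the second difference matrix\<close>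

lemma stiff_K_second_diff: "stiff_K N = (1 / mesh_h N) \<cdot>\<^sub>m second_diff N"
  by (rule eq_matI) (auto simp: stiff_K_def second_diff_def)

lemma mass_G_second_diff:
  "mass_G N = mesh_h N \<cdot>\<^sub>m (1\<^sub>m (N - 1) - (1 / 6) \<cdot>\<^sub>m second_diff N)"
  by (rule eq_matI) (auto simp: mass_G_def second_diff_def)

lemma mass_L_one: "mass_L N = mesh_h N \<cdot>\<^sub>m 1\<^sub>m (N - 1)"
  by (rule eq_matI) (auto simp: mass_L_def)

text \<open>The jumps of the hat functions at the interior nodes are the entries of
  \<open>second_diff N\<close> divided by the mesh size, so summing over nodes is a matrix product.
  The factor \<open>c\<close> covers both the weight of \<open>soft_S\<close> and that of
  \<open>soft_Sg\<close>.\<close>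

lemma sum_hat_jump:
  assumes "i < N - 1" "j < N - 1"
  shows "(\<Sum>m = 1..N - 1. c * hat_jump N (j + 1) m * hat_jump N (i + 1) m)
    = c / (mesh_h N)\<^sup>2 * (second_diff N * second_diff N) $$ (i, j)"
proof -
  have "(\<Sum>m = 1..N - 1. c * hat_jump N (j + 1) m * hat_jump N (i + 1) m)
    = (\<Sum>k = 0..<N - 1. c * hat_jump N (j + 1) (k + 1) * hat_jump N (i + 1) (k + 1))"
    by (rule sum.reindex_bij_witness[of _ "\<lambda>k. k + 1" "\<lambda>m. m - 1"]) auto
  also have "\<dots> = (\<Sum>k = 0..<N - 1. c / (mesh_h N)\<^sup>2 *
      (second_diff N $$ (i, k) * second_diff N $$ (k, j)))"
    using assms by (intro sum.cong)
      (auto simp: hat_jump_def second_diff_def power2_eq_square)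
  also have "\<dots> = c / (mesh_h N)\<^sup>2 * (second_diff N * second_diff N) $$ (i, j)"
    using assms by (simp add: scalar_prod_def second_diff_def sum_distrib_left)
  finally show ?thesis .
qed

lemma soft_S_second_diff:
  assumes "N > 0"
  shows "soft_S N = (1 / mesh_h N) \<cdot>\<^sub>m (second_diff N * second_diff N)"
proof (rule eq_matI)
  fix i j
  assume "i < dim_row ((1 / mesh_h N) \<cdot>\<^sub>m (second_diff N * second_diff N))"
    "j < dim_col ((1 / mesh_h N) \<cdot>\<^sub>m (second_diff N * second_diff N))"
  then have "i < N - 1" "j < N - 1" by (auto simp: second_diff_def)
  moreover have "mesh_h N \<noteq> 0" using assms by (simp add: mesh_h_def)
  ultimately show "soft_S N $$ (i, j) = ((1 / mesh_h N) \<cdot>\<^sub>m (second_diff N * second_diff N)) $$ (i, j)"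
    using sum_hat_jump[of i N j "mesh_h N"]
    by (simp add: soft_S_def power2_eq_square second_diff_def)
qed (auto simp: soft_S_def second_diff_def)

lemma soft_Sg_second_diff:
  assumes "N > 0"
  shows "soft_Sg N = mesh_h N \<cdot>\<^sub>m (second_diff N * second_diff N)"
proof (rule eq_matI)
  fix i j
  assume "i < dim_row (mesh_h N \<cdot>\<^sub>m (second_diff N * second_diff N))"
    "j < dim_col (mesh_h N \<cdot>\<^sub>m (second_diff N * second_diff N))"
  then have "i < N - 1" "j < N - 1" by (auto simp: second_diff_def)
  moreover have "mesh_h N \<noteq> 0" using assms by (simp add: mesh_h_def)
  ultimately show "soft_Sg N $$ (i, j) = (mesh_h N \<cdot>\<^sub>m (second_diff N * second_diff N)) $$ (i, j)"
    using sum_hat_jump[of i N j "mesh_h N ^ 3"]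
    by (simp add: soft_Sg_def power2_eq_square power3_eq_cube second_diff_def)
qed (auto simp: soft_Sg_def second_diff_def)

lemma second_diff_sq_mult_vec:
  assumes "v \<in> carrier_vec (N - 1)"
  shows "(second_diff N * second_diff N) *\<^sub>v v = second_diff N *\<^sub>v (second_diff N *\<^sub>v v)"
  using assms by (rule assoc_mult_mat_vec[OF second_diff_carrier second_diff_carrier])

lemma smult_mat_mult_vec:
  fixes A :: "real mat"
  assumes "A \<in> carrier_mat n m" "v \<in> carrier_vec m"
  shows "(k \<cdot>\<^sub>m A) *\<^sub>v v = k \<cdot>\<^sub>v (A *\<^sub>v v)"
  using assms by (intro eq_vecI) auto

lemma stiffness_eigenvector:
  assumes "v \<in> carrier_vec (N - 1)" "second_diff N *\<^sub>v v = t \<cdot>\<^sub>v v" "N > 0"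
  shows "(stiff_K N - etaK \<cdot>\<^sub>m soft_S N) *\<^sub>v v = ((t - etaK * t^2) / mesh_h N) \<cdot>\<^sub>v v"
proof -
  have "(second_diff N * second_diff N) *\<^sub>v v = t \<cdot>\<^sub>v (t \<cdot>\<^sub>v v)"
    using assms by (simp add: second_diff_sq_mult_vec mult_mat_vec[OF second_diff_carrier])
  then have "(stiff_K N - etaK \<cdot>\<^sub>m soft_S N) *\<^sub>v v
    = (1 / mesh_h N) \<cdot>\<^sub>v (t \<cdot>\<^sub>v v) - etaK \<cdot>\<^sub>v ((1 / mesh_h N) \<cdot>\<^sub>v (t \<cdot>\<^sub>v (t \<cdot>\<^sub>v v)))"
    using assms(1,2,3)
    by (simp add: stiff_K_second_diff soft_S_second_diff minus_mult_distrib_mat_vec[of _ "N - 1" "N - 1"]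
        smult_mat_mult_vec[of _ "N - 1" "N - 1"] mult_carrier_mat[of _ "N - 1" "N - 1" _ "N - 1"])
  also have "\<dots> = ((t - etaK * t^2) / mesh_h N) \<cdot>\<^sub>v v"
    using assms(1) by (intro eq_vecI) (auto simp: field_simps power2_eq_square diff_divide_distrib)
  finally show ?thesis .
qed

lemma mass_eigenvector:
  assumes "v \<in> carrier_vec (N - 1)" "second_diff N *\<^sub>v v = t \<cdot>\<^sub>v v" "N > 0"
  shows "(alpha \<cdot>\<^sub>m mass_G N + (1 - alpha) \<cdot>\<^sub>m mass_L N + etaM \<cdot>\<^sub>m soft_Sg N) *\<^sub>v v
    = (mesh_h N * (1 - alpha / 6 * t + etaM * t^2)) \<cdot>\<^sub>v v"
proof -
  have "(second_diff N * second_diff N) *\<^sub>v v = t \<cdot>\<^sub>v (t \<cdot>\<^sub>v v)"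
    using assms by (simp add: second_diff_sq_mult_vec mult_mat_vec[OF second_diff_carrier])
  then have "(alpha \<cdot>\<^sub>m mass_G N + (1 - alpha) \<cdot>\<^sub>m mass_L N + etaM \<cdot>\<^sub>m soft_Sg N) *\<^sub>v v
    = alpha \<cdot>\<^sub>v (mesh_h N \<cdot>\<^sub>v (v - (1 / 6) \<cdot>\<^sub>v (t \<cdot>\<^sub>v v))) + (1 - alpha) \<cdot>\<^sub>v (mesh_h N \<cdot>\<^sub>v v)
      + etaM \<cdot>\<^sub>v (mesh_h N \<cdot>\<^sub>v (t \<cdot>\<^sub>v (t \<cdot>\<^sub>v v)))"
    using assms
    by (simp add: mass_G_second_diff mass_L_one soft_Sg_second_diff minus_carrier_mat minus_mult_distrib_mat_vec[of _ "N - 1" "N - 1"]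
        add_mult_distrib_mat_vec[of _ "N - 1" "N - 1"]
        smult_mat_mult_vec[of _ "N - 1" "N - 1"] mult_carrier_mat[of _ "N - 1" "N - 1" _ "N - 1"])
  also have "\<dots> = (mesh_h N * (1 - alpha / 6 * t + etaM * t^2)) \<cdot>\<^sub>v v"
    using assms(1) by (intro eq_vecI) (auto simp: algebra_simps power2_eq_square)
  finally show ?thesis .
qed

section \<open>Generalized eigenvalues from the characteristic polynomial\<close>

lemma poly_gen_char_poly:
  assumes "A \<in> carrier_mat n n" "B \<in> carrier_mat n n"
  shows "poly (gen_char_poly A B) x = det (A - x \<cdot>\<^sub>m B)"
  unfolding gen_char_poly_def
  by (rule poly_det_cong[of _ n]) (use assms in auto)

lemma degree_gen_char_poly_le:
  assumes "A \<in> carrier_mat n n" "B \<in> carrier_mat n n"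
  shows "degree (gen_char_poly A B) \<le> n"
proof -
  have "degree (gen_char_poly A B) \<le> 1 * n"
    unfolding gen_char_poly_def
    by (rule degree_det_le) (use assms in \<open>auto intro!: degree_diff_le\<close>)
  then show ?thesis by simp
qed

text \<open>The value of the polynomial at 0 is \<open>det A\<close>, so it is not the zero
  polynomial; its degree is at most \<open>n\<close>. Thus \<open>n\<close> distinct roots are all
  simple and exhaust the multiset of roots.\<close>

lemma gen_eigenvalues_eqI:
  assumes A: "A \<in> carrier_mat n n" and B: "B \<in> carrier_mat n n"
    and det: "det A \<noteq> 0"
    and sorted: "sorted xs" and "distinct xs" and "length xs = n"
    and root: "\<And>x. x \<in> set xs \<Longrightarrow> det (A - x \<cdot>\<^sub>m B) = 0"
  shows "gen_eigenvalues A B = xs"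
proof -
  let ?p = "gen_char_poly A B"
  have "A - 0 \<cdot>\<^sub>m B = A"
    using A B by (intro eq_matI) auto
  then have p: "?p \<noteq> 0"
    using poly_gen_char_poly[OF A B, of 0] det by auto
  have sub: "mset xs \<subseteq># proots ?p"
  proof (rule mset_subset_eqI)
    fix a
    show "count (mset xs) a \<le> count (proots ?p) a"
    proof (cases "a \<in> set xs")
      case True
      then have "poly ?p a = 0"
        using root poly_gen_char_poly[OF A B] by simp
      then have "order a ?p > 0" using p by (simp add: order_gt_0_iff)
      moreover have "count (mset xs) a = 1"
        using True \<open>distinct xs\<close> by (simp add: distinct_count_atmost_1 count_mset)
      ultimately show ?thesis using p by simp
    next
      case False
      then have "a \<notin># mset xs" by simp
      then have "count (mset xs) a = 0" by (simp only: not_in_iff)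
      then show ?thesis by linarith
    qed
  qed
  have "size (proots ?p) \<le> size (mset xs)"
    using size_proots_le[of ?p] degree_gen_char_poly_le[OF A B] \<open>length xs = n\<close> by simp
  then have "mset xs = proots ?p"
    using sub mset_subset_size subset_mset.le_neq_trans by fastforce
  then show ?thesis
    using sorted by (simp add: gen_eigenvalues_def sorted_list_of_multiset_mset flip: \<open>mset xs = proots ?p\<close>)
      (simp add: sorted_sort_id)
qed

text \<open>The matrix is a multiple of \<open>T - etaK T^2\<close>. For \<open>v\<close> in its
  kernel, \<open>u = T v\<close> satisfies \<open>u = etaK T u\<close>, so 0 or
  \<open>1 / etaK\<close> would be an eigenvalue of \<open>T\<close>. Neither lies strictly between
  0 and 4.\<close>

lemma det_stiffness_nonzero:
  assumes "N > 0" "etaK < 1 / 4"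
  shows "det (stiff_K N - etaK \<cdot>\<^sub>m soft_S N) \<noteq> 0"
proof
  let ?n = "N - 1" and ?T = "second_diff N"
  have h: "mesh_h N > 0" using assms by (simp add: mesh_h_def)
  have c: "stiff_K N - etaK \<cdot>\<^sub>m soft_S N \<in> carrier_mat ?n ?n"
    by (simp add: stiff_K_def soft_S_def carrier_matI)
  assume "det (stiff_K N - etaK \<cdot>\<^sub>m soft_S N) = 0"
  then obtain v where v: "v \<in> carrier_vec ?n" "v \<noteq> 0\<^sub>v ?n"
    and "(stiff_K N - etaK \<cdot>\<^sub>m soft_S N) *\<^sub>v v = 0\<^sub>v ?n"
    using det_0_iff_vec_prod_zero[OF c] by auto
  moreover define u where "u = ?T *\<^sub>v v"
  moreover have u: "u \<in> carrier_vec ?n" unfolding u_def by (rule mult_mat_vec_carrier[OF second_diff_carrier v(1)])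
  ultimately have "(1 / mesh_h N) \<cdot>\<^sub>v u - etaK \<cdot>\<^sub>v ((1 / mesh_h N) \<cdot>\<^sub>v (?T *\<^sub>v u)) = 0\<^sub>v ?n"
    using assms
    by (simp add: stiff_K_second_diff soft_S_second_diff minus_mult_distrib_mat_vec[of _ "N - 1" "N - 1"]
        smult_mat_mult_vec[of _ "N - 1" "N - 1"] mult_carrier_mat[of _ "N - 1" "N - 1" _ "N - 1"]
        second_diff_sq_mult_vec)
  then have "\<forall>i < ?n. u $ i = etaK * (?T *\<^sub>v u) $ i"
    using h u by (auto simp: vec_eq_iff second_diff_def)
  then have eq: "u = etaK \<cdot>\<^sub>v (?T *\<^sub>v u)"
    using u by (intro eq_vecI) (auto simp: second_diff_def)
  have not_eig: "\<not> eigenvalue ?T c" if "c \<le> 0 \<or> c \<ge> 4" for c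
    using eigenvalue_second_diff[of N c] diff_eig_range[of _ N] that by fastforce
  show False
  proof (cases "u = 0\<^sub>v ?n")
    case True
    then have "?T *\<^sub>v v = 0 \<cdot>\<^sub>v v" using v by (intro eq_vecI) (auto simp: u_def)
    then have "eigenvalue ?T 0"
      using v by (auto simp: eigenvalue_def eigenvector_def second_diff_def)
    then show False using not_eig by simp
  next
    case False
    have "etaK \<noteq> 0"
    proof
      assume "etaK = 0"
      with eq have "u = 0 \<cdot>\<^sub>v (?T *\<^sub>v u)" by simp
      also have "\<dots> = 0\<^sub>v ?n" by (intro eq_vecI) (auto simp: second_diff_def)
      finally have "u = 0\<^sub>v ?n" .
      with False show False ..
    qed
    then have "?T *\<^sub>v u = (1 / etaK) \<cdot>\<^sub>v (etaK \<cdot>\<^sub>v (?T *\<^sub>v u))"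
      by (intro eq_vecI) auto
    then have "?T *\<^sub>v u = (1 / etaK) \<cdot>\<^sub>v u" using eq by simp
    then have "eigenvalue ?T (1 / etaK)"
      using u False by (auto simp: eigenvalue_def eigenvector_def second_diff_def)
    moreover have "1 / etaK \<le> 0 \<or> 1 / etaK \<ge> 4"
      using \<open>etaK \<noteq> 0\<close> assms(2) by (cases "etaK > 0") (auto simp: field_simps)
    ultimately show False using not_eig by blast
  qed
qed

section \<open>Sorted eigenvalues and their relative error\<close>

text \<open>The sine vectors are common eigenvectors of both matrices, and monotonicity of the
  symbol carries the increasing order of \<open>diff_eig\<close> over to the quotients, so the list
  is sorted and free of repetitions.\<close>

lemma gsq_eigenvalues_eq:
  assumes "N > 0" and etaK: "etaK < 1 / 4"
    and pos: "\<And>t. \<lbrakk>0 < t; t < 4\<rbrakk> \<Longrightarrow> 0 < 1 - alpha / 6 * t + etaM * t^2"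
    and mono: "\<And>s t. \<lbrakk>0 < s; s < t; t < 4\<rbrakk> \<Longrightarrow> gsq_ratio etaK etaM alpha s < gsq_ratio etaK etaM alpha t"
  shows "gsq_eigenvalues N etaK etaM alpha
    = map (\<lambda>j. gsq_ratio etaK etaM alpha (diff_eig N j) / (mesh_h N)\<^sup>2) [1..<N]"
  unfolding gsq_eigenvalues_def
proof (rule gen_eigenvalues_eqI)
  let ?n = "N - 1"
  let ?A = "stiff_K N - etaK \<cdot>\<^sub>m soft_S N"
  let ?B = "alpha \<cdot>\<^sub>m mass_G N + (1 - alpha) \<cdot>\<^sub>m mass_L N + etaM \<cdot>\<^sub>m soft_Sg N"
  let ?l = "\<lambda>j. gsq_ratio etaK etaM alpha (diff_eig N j) / (mesh_h N)\<^sup>2"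
  have h: "mesh_h N > 0" using assms by (simp add: mesh_h_def)
  show A: "?A \<in> carrier_mat ?n ?n"
    by (simp add: stiff_K_def soft_S_def carrier_matI)
  show B: "?B \<in> carrier_mat ?n ?n"
    by (simp add: mass_G_def mass_L_def soft_Sg_def carrier_matI)
  show "det ?A \<noteq> 0" by (rule det_stiffness_nonzero[OF \<open>N > 0\<close> etaK])
  have less: "?l i < ?l j" if "1 \<le> i" "i < j" "j < N" for i j
    using that h diff_eig_range[of _ N] diff_eig_less[of i j N]
    by (auto intro!: divide_strict_right_mono mono)
  then have "sorted_wrt (<) (map ?l [1..<N])"
    by (auto simp: sorted_wrt_map sorted_wrt_iff_nth_less)
  then show "sorted (map ?l [1..<N])" "distinct (map ?l [1..<N])"
    by (auto simp: strict_sorted_iff)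
  fix x assume "x \<in> set (map ?l [1..<N])"
  then obtain j where j: "j \<in> {1..<N}" and x: "x = ?l j" by auto
  let ?v = "sine_vec N j" and ?t = "diff_eig N j"
  have "1 - alpha / 6 * ?t + etaM * ?t^2 > 0"
    using diff_eig_range[OF j] by (rule pos)
  \<comment> \<open>The eigenvalue of \<open>?A\<close> carries a factor \<open>1 / h\<close> and
    that of \<open>?B\<close> a factor \<open>h\<close>, whence the division by the squared mesh
    size in \<open>?l\<close>.\<close>
  then have "(?t - etaK * ?t^2) / mesh_h N - x * (mesh_h N * (1 - alpha / 6 * ?t + etaM * ?t^2)) = 0"
    using h by (simp add: x gsq_ratio_def power2_eq_square)
  moreover have "(?A - x \<cdot>\<^sub>m ?B) *\<^sub>v ?v = ?A *\<^sub>v ?v - x \<cdot>\<^sub>v (?B *\<^sub>v ?v)"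
    using A B by (simp add: minus_mult_distrib_mat_vec[of _ ?n ?n] smult_mat_mult_vec[of _ ?n ?n])
  moreover have "a \<cdot>\<^sub>v ?v - x \<cdot>\<^sub>v (b \<cdot>\<^sub>v ?v) = (a - x * b) \<cdot>\<^sub>v ?v" for a b
    by (intro eq_vecI) (auto simp: algebra_simps)
  moreover have "0 \<cdot>\<^sub>v ?v = 0\<^sub>v ?n"
    by (intro eq_vecI) (auto simp: sine_vec_def)
  ultimately have "(?A - x \<cdot>\<^sub>m ?B) *\<^sub>v ?v = 0\<^sub>v ?n"
    using stiffness_eigenvector[OF sine_vec_carrier second_diff_sine_vec[OF j] \<open>N > 0\<close>]
      mass_eigenvector[OF sine_vec_carrier second_diff_sine_vec[OF j] \<open>N > 0\<close>]
    by simp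
  then show "det (?A - x \<cdot>\<^sub>m ?B) = 0"
    using A B sine_vec_nonzero[OF j]
    by (subst det_0_iff_vec_prod_zero[of _ ?n]) (auto intro!: exI[of _ ?v] minus_carrier_mat)
qed simp

theorem theorem3:
  fixes N :: nat
  assumes "N \<ge> 2"
  shows "\<forall>j \<in> {1..N - 1}.
     \<bar>gsq_eigenvalues N (31/252) (23/3780) (26/21) ! (j - 1) - (real j)^2 * pi^2\<bar>
       / ((real j)^2 * pi^2)
     < (1/30240) * (real j * pi * mesh_h N) ^ 8"
proof
  fix j assume j: "j \<in> {1..N - 1}"
  let ?f = "gsq_ratio (31/252) (23/3780) (26/21)"
  define h where "h = mesh_h N"
  define x where "x = real j * pi / real N"
  have h: "h > 0" and xh: "x = real j * pi * h"
    using assms by (simp_all add: h_def x_def mesh_h_def)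
  have x: "0 < x" "x < pi"
    using j assms by (auto simp: x_def field_simps)
  have "gsq_eigenvalues N (31/252) (23/3780) (26/21) = map (\<lambda>j. ?f (diff_eig N j) / h\<^sup>2) [1..<N]"
    unfolding h_def using assms
    by (intro gsq_eigenvalues_eq gsq_ratio_denominator_pos gsq_ratio_strict_mono) auto
  \<comment> \<open>List positions count from 0, whereas the list runs over \<open>j\<close> from
    1.\<close>
  moreover have "j - 1 < N - 1" "1 + (j - 1) = j" using j assms by auto
  ultimately have "gsq_eigenvalues N (31/252) (23/3780) (26/21) ! (j - 1) = ?f (2 - 2 * cos x) / h\<^sup>2"
    by (simp add: diff_eig_def x_def)
  moreover have jpi: "(real j)^2 * pi^2 = x^2 / h^2"
    using h by (simp add: xh power_mult_distrib)
  \<comment> \<open>Exact and discrete eigenvalues share the factor \<open>1 / h^2\<close>, which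
    cancels in the relative error.\<close>
  ultimately have "\<bar>gsq_eigenvalues N (31/252) (23/3780) (26/21) ! (j - 1) - (real j)^2 * pi^2\<bar>
      / ((real j)^2 * pi^2) = \<bar>(?f (2 - 2 * cos x) - x^2) / h^2\<bar> / (x^2 / h^2)"
    by (simp add: diff_divide_distrib)
  also have "\<dots> = \<bar>?f (2 - 2 * cos x) - x^2\<bar> / x^2"
    using h by (simp add: abs_divide)
  also have "\<dots> < ((x^2)^5 / 30240) / x^2"
    using gsq_ratio_symbol_error[OF x] x by (intro divide_strict_right_mono) auto
  also have "\<dots> = (1/30240) * x ^ 8"
    using x by (simp add: field_simps flip: power_mult power_add)
  finally show "\<bar>gsq_eigenvalues N (31/252) (23/3780) (26/21) ! (j - 1) - (real j)^2 * pi^2\<bar>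
      / ((real j)^2 * pi^2) < (1/30240) * (real j * pi * mesh_h N) ^ 8"
    by (simp add: xh h_def)
qed

end
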